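(* For integers $n\ge 1$ and $1\le q\le 2n$, let $\bar b=\bar b(n,q)$ denote the mean number of bridges of a bubble of size $q$, the average being taken over all bubbles of size $q$ found across all $(2n-1)!!$ linear chord diagrams with $n$ chords. Let $q=q(n)$ be a sequence of integers with $q(n)/n\to c$ for some constant $c\in(0,2)$ as $n\to\infty$. Then $$\bar b(n,q(n)) \sim \frac{q(n)\,(2n-q(n))}{2n}\qquad (n\to\infty),$$ i.e. the ratio of the two sides tends to $1$.
   Context: A linear chord diagram with $n$ chords is a perfect matching of the $2n$ vertices $1,2,\dots,2n$ arranged on a line; the matched pairs are called chords. A short chord is a chord joining two adjacent vertices $i,i+1$. A bubble is a non-empty set of consecutive vertices that is bounded on each side either by an end of the diagram or by a short chord, and which contains no vertex of a short chord (equivalently, a maximal run of consecutive vertices none of which belongs to a short chord). The size of a bubble is the number of vertices it contains. A bridge of a bubble is a chord joining a vertex of the bubble to a vertex outside the bubble. If $N_{q,b}(n)$ is the number of bubbles of size $q$ with exactly $b$ bridges, counted across all diagrams with $n$ chords, then $\bar b(n,q)=\sum_b b\,N_{q,b}(n)/\sum_b N_{q,b}(n)$. *)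

theory Defs
  imports Complex_Main "HOL-Library.Disjoint_Sets" "HOL-Library.Landau_Symbols"
begin

definition linear_chord_diagrams :: "nat \<Rightarrow> nat set set set" where
  "linear_chord_diagrams n = {M. partition_on {1..2*n} M \<and> (\<forall>c\<in>M. card c = 2)}"

definition short_chord :: "nat set set \<Rightarrow> nat set \<Rightarrow> bool" where
  "short_chord M c \<longleftrightarrow> c \<in> M \<and> (\<exists>i. c = {i, Suc i})"

(* A bubble {k..l}. As no vertex of a bubble lies on a short chord, a short chord bounding it
   consists of the two vertices immediately before k or immediately after l. *)
definition bubble :: "nat \<Rightarrow> nat set set \<Rightarrow> nat set \<Rightarrow> bool" where
  "bubble n M B \<longleftrightarrow>
     (\<exists>k l. 1 \<le> k \<and> k \<le> l \<and> l \<le> 2*n \<and> B = {k..l} \<and>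
        (k = 1 \<or> (\<exists>c. short_chord M c \<and> k - 1 \<in> c)) \<and>
        (l = 2*n \<or> (\<exists>c. short_chord M c \<and> l + 1 \<in> c)) \<and>
        (\<forall>c. short_chord M c \<longrightarrow> c \<inter> B = {}))"

definition bridges :: "nat set set \<Rightarrow> nat set \<Rightarrow> nat set set" where
  "bridges M B = {c \<in> M. \<exists>v w. c = {v, w} \<and> v \<in> B \<and> w \<notin> B}"

definition bubbles_with_bridges :: "nat \<Rightarrow> nat \<Rightarrow> nat \<Rightarrow> (nat set set \<times> nat set) set" where
  "bubbles_with_bridges n q b =
     {(M, B). M \<in> linear_chord_diagrams n \<and> bubble n M B \<and> card B = q \<and> card (bridges M B) = b}"

definition num_bubbles :: "nat \<Rightarrow> nat \<Rightarrow> nat \<Rightarrow> nat" where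
  "num_bubbles n q b = card (bubbles_with_bridges n q b)"

(* Bridges are chords, so b ranges over {..n}; see card_bridges_le below.
   The value is 0 if there is no bubble of size q. *)
definition mean_bridges :: "nat \<Rightarrow> nat \<Rightarrow> real" where
  "mean_bridges n q =
     (\<Sum>b\<le>n. real b * real (num_bubbles n q b)) / (\<Sum>b\<le>n. real (num_bubbles n q b))"

lemma finite_linear_chord_diagram:
  assumes "M \<in> linear_chord_diagrams n"
  shows "finite M"
  using assms by (auto simp: linear_chord_diagrams_def intro: finite_elements)

lemma card_linear_chord_diagram:
  assumes "M \<in> linear_chord_diagrams n"
  shows "card M = n"
proof -
  have p: "partition_on {1..2*n} M" and c: "\<And>c. c \<in> M \<Longrightarrow> card c = 2"
    using assms by (auto simp: linear_chord_diagrams_def)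
  have "2 * n = card (\<Union>M)"
    by (simp flip: partition_onD1[OF p])
  also have "\<dots> = (\<Sum>c\<in>M. card c)"
    using partition_onD2[OF p] c by (intro card_Union_disjoint) (auto simp: disjoint_def pairwise_def
        disjnt_def intro: card_ge_0_finite)
  also have "\<dots> = 2 * card M"
    using c by simp
  finally show ?thesis by simp
qed

lemma card_bridges_le:
  assumes "M \<in> linear_chord_diagrams n"
  shows "card (bridges M B) \<le> n"
proof -
  have "card (bridges M B) \<le> card M"
    using finite_linear_chord_diagram[OF assms] by (intro card_mono) (auto simp: bridges_def)
  then show ?thesis
    using card_linear_chord_diagram[OF assms] by simp
qed

lemma finite_bubbles_with_bridges: "finite (bubbles_with_bridges n q b)"
proof (rule finite_subset)
  show "bubbles_with_bridges n q b \<subseteq> Pow (Pow {1..2*n}) \<times> Pow {1..2*n}"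
    by (auto simp: bubbles_with_bridges_def linear_chord_diagrams_def bubble_def partition_on_def)
qed simp

end

theory Submission
  imports Defs "HOL-Real_Asymp.Real_Asymp"
begin

text \<open>
  Fix the vertex set \<open>B\<close> of a bubble of size \<open>q\<close>. Deleting the at most two short chords that bound it
  turns the diagrams with bubble \<open>B\<close> into the perfect matchings of the remaining \<open>2m\<close> vertices
  that have no short chord inside \<open>B\<close>. Under the uniform distribution on all perfect matchings of
  these vertices, the number of bridges has mean \<open>\<mu> = qr/(2m - 1)\<close>, where \<open>r = 2m - q\<close>, and variance
  at most \<open>\<mu>\<close>. By a union bound, the condition that \<open>B\<close> contains no short chord has probability
  at least \<open>(r - 1)/(2m - 1)\<close>, which stays away from \<open>0\<close> because \<open>c < 2\<close>. Conditioning on it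
  therefore moves the mean only by \<open>O(\<surd>n)\<close>, uniformly in \<open>B\<close>, whereas \<open>\<mu>\<close> is of order \<open>n\<close>.
\<close>

section \<open>Perfect matchings of arbitrary vertex sets\<close>

text \<open>Deleting chords leaves vertex sets with gaps, so general \<open>S\<close> is allowed;
  the labels are kept so that adjacency still refers to the original line.\<close>

definition perfect_matchings :: "'a set \<Rightarrow> 'a set set set" where
  "perfect_matchings S = {M. partition_on S M \<and> (\<forall>c\<in>M. card c = 2)}"

lemma perfect_matchings_subset: "perfect_matchings S \<subseteq> Pow (Pow S)"
  by (auto simp: perfect_matchings_def partition_on_def)

lemma finite_perfect_matchings: "finite S \<Longrightarrow> finite (perfect_matchings S)"
  by (rule finite_subset[OF perfect_matchings_subset]) simp

lemma perfect_matchings_unique: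
  assumes "M \<in> perfect_matchings S" "c \<in> M" "d \<in> M" "x \<in> c" "x \<in> d"
  shows "c = d"
  using assms by (auto simp: perfect_matchings_def partition_on_def disjoint_def)

lemma perfect_matchings_singleton: "v \<noteq> w \<Longrightarrow> {{v, w}} \<in> perfect_matchings {v, w}"
  by (auto simp: perfect_matchings_def partition_on_def disjoint_def)

lemma perfect_matchings_Un:
  assumes "M \<in> perfect_matchings S" "T \<in> perfect_matchings U" "S \<inter> U = {}"
  shows "M \<union> T \<in> perfect_matchings (S \<union> U)" "M \<inter> T = {}"
proof -
  have M: "\<Union>M = S" "disjoint M" "{} \<notin> M" "\<forall>c\<in>M. card c = 2"
    and T: "\<Union>T = U" "disjoint T" "{} \<notin> T" "\<forall>c\<in>T. card c = 2"
    using assms by (auto simp: perfect_matchings_def partition_on_def)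
  have "disjoint (M \<union> T)"
    using M(2) T(2) M(1) T(1) assms(3) by (intro disjoint_union) auto
  then show "M \<union> T \<in> perfect_matchings (S \<union> U)"
    using M T by (auto simp: perfect_matchings_def partition_on_def)
  show "M \<inter> T = {}"
  proof (rule ccontr)
    assume "M \<inter> T \<noteq> {}"
    then obtain c where c: "c \<in> M" "c \<in> T" by auto
    then have "c \<subseteq> S \<inter> U" using M(1) T(1) by blast
    then show False using assms(3) c M(3) by auto
  qed
qed

lemma perfect_matchings_Diff:
  assumes "M \<in> perfect_matchings S" "T \<subseteq> M"
  shows "M - T \<in> perfect_matchings (S - \<Union>T)"
proof -
  have M: "\<Union>M = S" "disjoint M" "{} \<notin> M" "\<forall>c\<in>M. card c = 2"
    using assms by (auto simp: perfect_matchings_def partition_on_def)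
  have "\<Union>(M - T) = S - \<Union>T"
    using M(1,2) assms(2) unfolding disjoint_def by fastforce
  moreover have "disjoint (M - T)"
    using M(2) by (auto simp: disjoint_def)
  ultimately show ?thesis
    using M by (auto simp: perfect_matchings_def partition_on_def)
qed

text \<open>Fixing the chords of \<open>T\<close> leaves only the vertices off \<open>U\<close> to
  be matched. This serves both to fix a single chord when counting and to split off the chords that
  bound a bubble.\<close>

lemma bij_betw_perfect_matchings_extend:
  assumes "T \<in> perfect_matchings U" "U \<subseteq> S"
  shows "bij_betw (\<lambda>M. M \<union> T) (perfect_matchings (S - U)) {M \<in> perfect_matchings S. T \<subseteq> M}"
proof (rule bij_betw_byWitness[where f' = "\<lambda>M. M - T"])
  have U: "\<Union>T = U" using assms by (auto simp: perfect_matchings_def partition_on_def)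
  have SU: "(S - U) \<union> U = S" "(S - U) \<inter> U = {}" using assms by auto
  show "\<forall>M\<in>perfect_matchings (S - U). M \<union> T - T = M"
    using perfect_matchings_Un(2)[OF _ assms(1) SU(2)] by blast
  show "\<forall>M\<in>{M \<in> perfect_matchings S. T \<subseteq> M}. M - T \<union> T = M" by blast
  show "(\<lambda>M. M \<union> T) ` perfect_matchings (S - U) \<subseteq> {M \<in> perfect_matchings S. T \<subseteq> M}"
    using perfect_matchings_Un(1)[OF _ assms(1) SU(2)] SU(1) by auto
  show "(\<lambda>M. M - T) ` {M \<in> perfect_matchings S. T \<subseteq> M} \<subseteq> perfect_matchings (S - U)"
    using perfect_matchings_Diff U by blast
qed

section \<open>Counting perfect matchings\<close>

text \<open>The value at \<open>m\<close> is the double factorial \<open>(2m - 1)!!\<close>.\<close>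

primrec odd_fact :: "nat \<Rightarrow> nat" where
  "odd_fact 0 = 1"
| "odd_fact (Suc m) = (2 * m + 1) * odd_fact m"

lemma odd_fact_pos: "odd_fact m > 0"
  by (induction m) auto

lemma perfect_matchings_of_empty: "perfect_matchings {} = {{}}"
  by (auto simp: perfect_matchings_def partition_on_def)

lemma card_Diff_doubleton:
  assumes "finite S" "card S = 2 * Suc m" "v \<in> S" "w \<in> S" "v \<noteq> w"
  shows "card (S - {v, w}) = 2 * m"
  using assms by (simp add: card_Diff_subset)

text \<open>Among \<open>2 * Suc m\<close> vertices a fixed vertex has \<open>2 * m + 1\<close>
  possible partners, and each choice leaves a matching of the other \<open>2 * m\<close>
  vertices.\<close>

lemma card_perfect_matchings:
  assumes "finite S" "card S = 2 * m"
  shows "card (perfect_matchings S) = odd_fact m"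
  using assms
proof (induction m arbitrary: S)
  case 0
  then show ?case by (simp add: perfect_matchings_of_empty)
next
  case (Suc m)
  then obtain v where v: "v \<in> S" by fastforce
  have "perfect_matchings S = (\<Union>w\<in>S - {v}. {M \<in> perfect_matchings S. {{v, w}} \<subseteq> M})"
  proof (intro equalityI subsetI)
    fix M assume M: "M \<in> perfect_matchings S"
    then obtain c where c: "c \<in> M" "v \<in> c" "card c = 2" "c \<subseteq> S"
      using v by (auto simp: perfect_matchings_def partition_on_def)
    then obtain w where "c = {v, w}" "w \<noteq> v"
      by (auto simp: card_2_iff)
    then show "M \<in> (\<Union>w\<in>S - {v}. {M \<in> perfect_matchings S. {{v, w}} \<subseteq> M})"
      using c M by auto
  qed auto
  also have "card \<dots> = (\<Sum>w\<in>S - {v}. card {M \<in> perfect_matchings S. {{v, w}} \<subseteq> M})"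
  proof (rule card_UN_disjoint)
    show "\<forall>i\<in>S - {v}. \<forall>j\<in>S - {v}. i \<noteq> j \<longrightarrow>
      {M \<in> perfect_matchings S. {{v, i}} \<subseteq> M} \<inter> {M \<in> perfect_matchings S. {{v, j}} \<subseteq> M} = {}"
    proof (intro ballI impI equals0I)
      fix i j M
      assume "i \<noteq> j" and M: "M \<in> {M \<in> perfect_matchings S. {{v, i}} \<subseteq> M} \<inter>
        {M \<in> perfect_matchings S. {{v, j}} \<subseteq> M}"
      then have "{v, i} = {v, j}"
        using perfect_matchings_unique[of M S "{v, i}" "{v, j}" v] by simp
      then show False using \<open>i \<noteq> j\<close> by (simp add: doubleton_eq_iff)
    qed
  qed (simp_all add: Suc.prems(1) finite_perfect_matchings)
  also have "\<dots> = (\<Sum>w\<in>S - {v}. odd_fact m)"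
  proof (rule sum.cong)
    fix w assume w: "w \<in> S - {v}"
    then have "card {M \<in> perfect_matchings S. {{v, w}} \<subseteq> M} = card (perfect_matchings (S - {v, w}))"
      using bij_betw_perfect_matchings_extend[OF perfect_matchings_singleton, of v w S] v
      by (intro bij_betw_same_card[symmetric, of "\<lambda>M. M \<union> {{v, w}}"]) auto
    also have "\<dots> = odd_fact m"
      using Suc.prems v w by (intro Suc.IH card_Diff_doubleton) auto
    finally show "card {M \<in> perfect_matchings S. {{v, w}} \<subseteq> M} = odd_fact m" .
  qed simp
  also have "\<dots> = odd_fact (Suc m)"
    using Suc.prems v by simp
  finally show ?case .
qed

lemma card_perfect_matchings_containing:
  assumes "finite S" "card S = 2 * Suc m" "v \<in> S" "w \<in> S" "v \<noteq> w"
  shows "card {M \<in> perfect_matchings S. {v, w} \<in> M} = odd_fact m"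
proof -
  have "card {M \<in> perfect_matchings S. {v, w} \<in> M} = card (perfect_matchings (S - {v, w}))"
    using bij_betw_perfect_matchings_extend[OF perfect_matchings_singleton, of v w S] assms
    by (intro bij_betw_same_card[symmetric, of "\<lambda>M. M \<union> {{v, w}}"]) auto
  also have "\<dots> = odd_fact m"
    using assms by (intro card_perfect_matchings card_Diff_doubleton) auto
  finally show ?thesis .
qed

section \<open>First and second moments of the number of bridges\<close>

text \<open>A bridge has exactly one end in \<open>B\<close>, so it determines the ordered pair of
  its inner and outer end. The number of bridges thus becomes a sum of indicators over
  pairs.\<close>

lemma card_bridges_eq:
  assumes "M \<in> perfect_matchings S" "B \<subseteq> S"
  shows "card (bridges M B) = card {(v, w) \<in> B \<times> (S - B). {v, w} \<in> M}"
proof -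
  let ?E = "{(v, w) \<in> B \<times> (S - B). {v, w} \<in> M}"
  have U: "\<Union>M = S" using assms by (auto simp: perfect_matchings_def partition_on_def)
  have "inj_on (\<lambda>(v, w). {v, w}) ?E"
    by (auto simp: inj_on_def doubleton_eq_iff)
  moreover have "(\<lambda>(v, w). {v, w}) ` ?E = bridges M B"
  proof (intro equalityI subsetI)
    fix c assume "c \<in> bridges M B"
    then obtain v w where c: "c \<in> M" "c = {v, w}" "v \<in> B" "w \<notin> B"
      by (auto simp: bridges_def)
    then have "w \<in> S" using U by auto
    then show "c \<in> (\<lambda>(v, w). {v, w}) ` ?E"
      using c by (intro image_eqI[of _ _ "(v, w)"]) auto
  qed (auto simp: bridges_def)
  ultimately have "bij_betw (\<lambda>(v, w). {v, w}) ?E (bridges M B)"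
    by (simp add: bij_betw_def)
  then show ?thesis by (rule bij_betw_same_card[symmetric])
qed

lemma card_bridges_sum:
  assumes "M \<in> perfect_matchings S" "B \<subseteq> S" "finite S"
  shows "card (bridges M B) = (\<Sum>(v, w)\<in>B \<times> (S - B). of_bool ({v, w} \<in> M))"
proof -
  have "finite B" using assms finite_subset by auto
  moreover have "{(v, w) \<in> B \<times> (S - B). {v, w} \<in> M} = (B \<times> (S - B)) \<inter> {x. {fst x, snd x} \<in> M}"
    by auto
  ultimately show ?thesis
    using assms(3) by (simp add: card_bridges_eq[OF assms(1,2)] case_prod_unfold)
qed

text \<open>Double counting of matchings with a marked bridge, followed by deletion of that bridge.
  The weight \<open>f\<close> lets one identity serve both moments: constant 1 gives the first, the
  number of bridges the second.\<close>

lemma sum_card_bridges_mult: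
  fixes f :: "nat set set \<Rightarrow> nat"
  assumes "finite S" "B \<subseteq> S"
  shows "(\<Sum>M\<in>perfect_matchings S. card (bridges M B) * f M) =
    (\<Sum>(v, w)\<in>B \<times> (S - B). \<Sum>M\<in>perfect_matchings (S - {v, w}). f (insert {v, w} M))"
proof -
  have "(\<Sum>M\<in>perfect_matchings S. card (bridges M B) * f M) =
    (\<Sum>M\<in>perfect_matchings S. \<Sum>x\<in>B \<times> (S - B). of_bool ({fst x, snd x} \<in> M) * f M)"
    using assms by (intro sum.cong) (auto simp: card_bridges_sum[of _ S] sum_distrib_right case_prod_unfold)
  also have "\<dots> = (\<Sum>x\<in>B \<times> (S - B). \<Sum>M\<in>perfect_matchings S. of_bool ({fst x, snd x} \<in> M) * f M)"
    by (rule sum.swap)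
  also have "\<dots> = (\<Sum>(v, w)\<in>B \<times> (S - B). \<Sum>M\<in>perfect_matchings (S - {v, w}). f (insert {v, w} M))"
  proof (rule sum.cong, simp, clarsimp)
    fix v w assume vw: "v \<in> B" "w \<in> S" "w \<notin> B"
    have "(\<Sum>M\<in>perfect_matchings S. of_bool ({v, w} \<in> M) * f M) =
      (\<Sum>M\<in>{M \<in> perfect_matchings S. {{v, w}} \<subseteq> M}. f M)"
      using finite_perfect_matchings[OF assms(1)] 
      by (intro sum.mono_neutral_cong_right) auto
    also have "\<dots> = (\<Sum>M\<in>perfect_matchings (S - {v, w}). f (M \<union> {{v, w}}))"
      using vw assms
      by (intro sum.reindex_bij_betw[symmetric] bij_betw_perfect_matchings_extend
          perfect_matchings_singleton) auto
    finally show "(\<Sum>M\<in>perfect_matchings S. of_bool ({v, w} \<in> M) * f M) =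
      (\<Sum>M\<in>perfect_matchings (S - {v, w}). f (insert {v, w} M))" by simp
  qed
  finally show ?thesis .
qed

lemma sum_card_bridges:
  assumes "finite S" "card S = 2 * Suc m" "B \<subseteq> S" 
  shows "(\<Sum>M\<in>perfect_matchings S. card (bridges M B)) = card B * card (S - B) * odd_fact m"
proof -
  have "(\<Sum>M\<in>perfect_matchings S. card (bridges M B)) =
     (\<Sum>(v, w)\<in>B \<times> (S - B). \<Sum>M\<in>perfect_matchings (S - {v, w}). 1)"
    using sum_card_bridges_mult[OF assms(1,3), of "\<lambda>_. 1"] by simp
  also have "\<dots> = (\<Sum>(v, w)\<in>B \<times> (S - B). odd_fact m)"
    using assms by (intro sum.cong) (auto intro!: card_perfect_matchings card_Diff_doubleton)
  finally show ?thesis by (simp add: card_cartesian_product case_prod_unfold)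
qed

text \<open>No chord of \<open>M\<close> contains \<open>v\<close>, so taking \<open>v\<close> out
  of \<open>B\<close> does not affect the bridges of \<open>M\<close>. It is done so that the set
  lies within the vertices of \<open>M\<close> when \<open>sum_card_bridges\<close> is
  applied.\<close>

lemma card_bridges_insert:
  assumes "M \<in> perfect_matchings (S - {v, w})" "v \<in> B" "w \<notin> B" "finite S"
  shows "card (bridges (insert {v, w} M) B) = Suc (card (bridges M (B - {v})))"
proof -
  have U: "\<Union>M = S - {v, w}" using assms by (auto simp: perfect_matchings_def partition_on_def)
  have fin: "finite M"
    using U assms(4) by (metis finite_Diff finite_UnionD)
  have v: "v \<notin> c" if "c \<in> M" for c using U that by auto
  have "bridges (insert {v, w} M) B = insert {v, w} (bridges M (B - {v}))"
  proof (intro equalityI subsetI)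
    fix c assume "c \<in> bridges (insert {v, w} M) B"
    then obtain x y where c: "c = {v, w} \<or> c \<in> M" "c = {x, y}" "x \<in> B" "y \<notin> B"
      by (auto simp: bridges_def)
    show "c \<in> insert {v, w} (bridges M (B - {v}))"
    proof (cases "c = {v, w}")
      case False
      then have "x \<noteq> v" using c v by auto
      then show ?thesis using c False unfolding bridges_def by blast
    qed simp
  next
    fix c assume "c \<in> insert {v, w} (bridges M (B - {v}))"
    then consider "c = {v, w}" | x y where "c \<in> M" "c = {x, y}" "x \<in> B" "y \<notin> B - {v}"
      by (auto simp: bridges_def)
    then show "c \<in> bridges (insert {v, w} M) B"
    proof cases
      case 1
      then show ?thesis using assms(2,3) by (auto simp: bridges_def)
    next
      case 2
      then have "y \<noteq> v" using v by auto
      then show ?thesis using 2 unfolding bridges_def by blast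
    qed
  qed
  moreover have "{v, w} \<notin> bridges M (B - {v})"
    using v by (auto simp: bridges_def)
  moreover have "finite (bridges M (B - {v}))"
    using fin by (simp add: bridges_def)
  ultimately show ?thesis by simp
qed

text \<open>Once a bridge is fixed, the first moment applies to the smaller problem with one vertex
  fewer on either side. The summand \<open>odd_fact (Suc m)\<close> counts the fixed bridge
  itself.\<close>

lemma sum_card_bridges_square:
  assumes "finite S" "card S = 2 * Suc (Suc m)" "B \<subseteq> S" 
  shows "(\<Sum>M\<in>perfect_matchings S. card (bridges M B) ^ 2) =
    card B * card (S - B) * (odd_fact (Suc m) + (card B - 1) * (card (S - B) - 1) * odd_fact m)"
proof -
  have "(\<Sum>M\<in>perfect_matchings S. card (bridges M B) ^ 2) =
     (\<Sum>(v, w)\<in>B \<times> (S - B). \<Sum>M\<in>perfect_matchings (S - {v, w}). card (bridges (insert {v, w} M) B))"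
    using sum_card_bridges_mult[OF assms(1,3), of "\<lambda>M. card (bridges M B)"] by (simp add: power2_eq_square)
  also have "\<dots> = (\<Sum>(v, w)\<in>B \<times> (S - B). 
     odd_fact (Suc m) + (card B - 1) * (card (S - B) - 1) * odd_fact m)"
  proof (rule sum.cong, simp, clarify)
    fix v w assume vw: "v \<in> B" "w \<in> S" "w \<notin> B"
    have c: "card (S - {v, w}) = 2 * Suc m"
      using vw assms by (intro card_Diff_doubleton) auto
    have c': "finite (S - {v, w})" "B - {v} \<subseteq> S - {v, w}"
      using vw assms by auto
    have eq: "S - {v, w} - (B - {v}) = S - B - {w}" using vw by auto
    have "(\<Sum>M\<in>perfect_matchings (S - {v, w}). card (bridges (insert {v, w} M) B)) =
       (\<Sum>M\<in>perfect_matchings (S - {v, w}). 1 + card (bridges M (B - {v})))"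
      using vw assms by (intro sum.cong) (auto simp: card_bridges_insert)
    also have "\<dots> = odd_fact (Suc m) + card (B - {v}) * card (S - B - {w}) * odd_fact m"
      using sum_card_bridges[OF c'(1) c c'(2)] card_perfect_matchings[OF c'(1) c]
      by (simp add: sum_Suc eq del: odd_fact.simps)
    finally show "(\<Sum>M\<in>perfect_matchings (S - {v, w}). card (bridges (insert {v, w} M) B)) =
       odd_fact (Suc m) + (card B - 1) * (card (S - B) - 1) * odd_fact m"
      using vw by simp
  qed
  finally show ?thesis by (simp add: card_cartesian_product case_prod_unfold)
qed

text \<open>This is the variance bound times the number of matchings. The exact value is the
  right-hand side minus a nonnegative multiple of \<open>K - 2 * \<mu>\<close>, where
  \<open>K\<close> is one less than the number of vertices, so it remains to see that
  \<open>2 * \<mu> \<le> K\<close>.\<close>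

lemma sum_bridges_deviation_square:
  fixes B S :: "nat set"
  assumes "finite S" "card S = 2 * Suc (Suc m)" "B \<subseteq> S"
  defines "\<mu> \<equiv> real (card B) * real (card (S - B)) / (2 * real m + 3)"
  shows "(\<Sum>M\<in>perfect_matchings S. (real (card (bridges M B)) - \<mu>)\<^sup>2) \<le>
    \<mu> * real (card (perfect_matchings S))"
proof -
  define q r P where "q = real (card B)" and "r = real (card (S - B))" and "P = real (odd_fact m)"
  define X where "X = (\<lambda>M. real (card (bridges M B)))"
  define K where "K = 2 * real m + 3"
  have "card B + card (S - B) = 2 * m + 4"
    using card_mono[OF assms(1,3)] finite_subset[OF assms(3,1)] assms(2)
    by (simp add: card_Diff_subset[OF _ assms(3)])
  then have "real (card B + card (S - B)) = real (2 * m + 4)" by simp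
  then have qr: "q + r = K + 1" by (simp add: q_def r_def K_def)
  have pos: "q \<ge> 0" "r \<ge> 0" "P \<ge> 0" "K > 0" by (simp_all add: q_def r_def P_def K_def)
  have \<mu>: "\<mu> * K = q * r" using pos by (simp add: \<mu>_def q_def r_def K_def)
  have P1: "real (odd_fact (Suc m)) = (K - 2) * P" "real (odd_fact (Suc (Suc m))) = K * (K - 2) * P"
    by (simp_all add: P_def K_def algebra_simps)
  have C: "real (card (perfect_matchings S)) = K * (K - 2) * P"
    using card_perfect_matchings[OF assms(1,2)] P1(2) by presburger
  have "(\<Sum>M\<in>perfect_matchings S. X M) = real (\<Sum>M\<in>perfect_matchings S. card (bridges M B))"
    by (simp add: X_def)
  also have "\<dots> = q * r * ((K - 2) * P)"
    unfolding sum_card_bridges[OF assms(1-3)] of_nat_mult P1 q_def r_def ..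
  finally have X1: "(\<Sum>M\<in>perfect_matchings S. X M) = q * r * ((K - 2) * P)" .
  \<comment> \<open>The subtractions of naturals truncate when \<open>B\<close> or its complement is
    empty, but then \<open>q * r\<close> vanishes. Otherwise \<open>q + r = K + 1\<close> gives
    \<open>(q - 1) * (r - 1) = q * r - K\<close>.\<close>
  have prod: "q * r * real ((card B - 1) * (card (S - B) - 1)) = q * r * (q * r - K)"
  proof (cases "card B = 0 \<or> card (S - B) = 0")
    case True
    then have "q * r = 0" by (auto simp: q_def r_def)
    then show ?thesis by simp
  next
    case False
    then have "real ((card B - 1) * (card (S - B) - 1)) = (q - 1) * (r - 1)"
      by (simp add: q_def r_def of_nat_diff Suc_leI)
    also have "\<dots> = q * r - K" using qr by (simp add: algebra_simps)
    finally show ?thesis by simp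
  qed
  have "(\<Sum>M\<in>perfect_matchings S. (X M)\<^sup>2) =
      real (\<Sum>M\<in>perfect_matchings S. card (bridges M B) ^ 2)"
    by (simp add: X_def)
  also have "\<dots> = q * r * ((K - 2) * P) + q * r * real ((card B - 1) * (card (S - B) - 1)) * P"
    unfolding sum_card_bridges_square[OF assms(1-3)] of_nat_mult of_nat_add P1 q_def r_def P_def
    by (simp add: algebra_simps)
  finally have X2: "(\<Sum>M\<in>perfect_matchings S. (X M)\<^sup>2) =
      q * r * ((K - 2) * P) + q * r * (q * r - K) * P"
    by (simp only: prod)
  have "(\<Sum>M\<in>perfect_matchings S. (X M - \<mu>)\<^sup>2) =
      (\<Sum>M\<in>perfect_matchings S. (X M)\<^sup>2 - 2 * \<mu> * X M + \<mu>\<^sup>2)"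
    by (simp add: power2_diff algebra_simps)
  also have "\<dots> = (\<Sum>M\<in>perfect_matchings S. (X M)\<^sup>2) - 2 * \<mu> * (\<Sum>M\<in>perfect_matchings S. X M) +
      \<mu>\<^sup>2 * real (card (perfect_matchings S))"
    by (simp add: sum.distrib sum_subtractf sum_distrib_left)
  \<comment> \<open>Writing every \<open>q * r\<close> as \<open>\<mu> * K\<close> leaves a
    polynomial without divisions.\<close>
  also have "\<dots> = \<mu> * K * ((K - 2) * P) + \<mu> * K * (\<mu> * K - K) * P
      - 2 * \<mu> * (\<mu> * K * ((K - 2) * P)) + \<mu>\<^sup>2 * (K * (K - 2) * P)"
    unfolding X1 X2 C \<mu> by simp
  also have "\<dots> = \<mu> * (K * (K - 2) * P) - \<mu> * K * P * (K - 2 * \<mu>)"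
    by (simp add: algebra_simps power2_eq_square)
  also have "\<dots> \<le> \<mu> * (K * (K - 2) * P)"
  proof -
    \<comment> \<open>The inequality of arithmetic and geometric means bounds \<open>q * r\<close>;
      then \<open>K \<ge> 3\<close> absorbs the \<open>+ 1\<close>.\<close>
    have "0 \<le> (q - r)\<^sup>2" by simp
    then have "4 * (q * r) \<le> (K + 1)\<^sup>2" unfolding qr[symmetric] by (simp add: power2_eq_square algebra_simps)
    also have "\<dots> \<le> 2 * K * K"
    proof -
      have "3 * (K - 3) \<le> K * (K - 3)" by (rule mult_right_mono) (auto simp: K_def)
      then show ?thesis using K_def by (simp add: power2_eq_square algebra_simps)
    qed
    finally have "2 * \<mu> * K \<le> K * K" using \<mu> by simp
    then have "2 * \<mu> \<le> K" using pos by simp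
    moreover have "\<mu> \<ge> 0" by (simp add: \<mu>_def)
    ultimately show ?thesis using pos by simp
  qed
  finally show ?thesis unfolding C X_def .
qed

section \<open>Conditioning on the absence of short chords\<close>

text \<open>Only chords with both ends in \<open>B\<close> are excluded: after removal of the
  bounding chords of a bubble, the neighbours of \<open>B\<close> are missing from \<open>S\<close>,
  so no short chord can straddle an end of \<open>B\<close>.\<close>

definition short_free_matchings :: "nat set \<Rightarrow> nat set \<Rightarrow> nat set set set" where
  "short_free_matchings S B =
     {M \<in> perfect_matchings S. \<forall>i. i \<in> B \<and> Suc i \<in> B \<longrightarrow> {i, Suc i} \<notin> M}"

text \<open>Union bound over at most \<open>card B\<close> positions, each short chord lying in
  \<open>odd_fact m\<close> matchings.\<close>

lemma card_short_free_matchings_ge: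
  assumes "finite S" "card S = 2 * Suc m" "B \<subseteq> S"
  shows "card (perfect_matchings S) \<le> card (short_free_matchings S B) + card B * odd_fact m"
proof -
  let ?I = "{i \<in> B. Suc i \<in> B}"
  let ?C = "\<lambda>i. {M \<in> perfect_matchings S. {i, Suc i} \<in> M}"
  have fB: "finite B" using assms finite_subset by blast
  have fin: "finite (short_free_matchings S B)"
    using finite_perfect_matchings[OF assms(1)] by (simp add: short_free_matchings_def)
  have "card (perfect_matchings S) \<le> card (short_free_matchings S B \<union> (\<Union>i\<in>?I. ?C i))"
    using fin fB finite_perfect_matchings[OF assms(1)]
    by (intro card_mono) (auto simp: short_free_matchings_def)
  also have "\<dots> \<le> card (short_free_matchings S B) + card (\<Union>i\<in>?I. ?C i)"
    by (rule card_Un_le)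
  also have "card (\<Union>i\<in>?I. ?C i) \<le> (\<Sum>i\<in>?I. card (?C i))"
    using fB by (intro card_UN_le) auto
  also have "\<dots> = (\<Sum>i\<in>?I. odd_fact m)"
    using assms by (intro sum.cong card_perfect_matchings_containing) auto
  also have "\<dots> \<le> card B * odd_fact m"
    using fB by (auto intro!: mult_right_mono card_mono)
  finally show ?thesis by simp
qed

text \<open>The last hypothesis says that \<open>\<delta>\<close> is at most
  \<open>1 - card B / (2 * m + 1)\<close>, which is what the union bound gives for the
  probability.\<close>

lemma short_free_matchings_large:
  assumes "finite S" "card S = 2 * Suc m" "B \<subseteq> S"
    and "\<delta> * (2 * real m + 1) \<le> 2 * real m + 1 - real (card B)"
  shows "\<delta> * real (card (perfect_matchings S)) \<le> real (card (short_free_matchings S B))"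
proof -
  have C: "real (card (perfect_matchings S)) = (2 * real m + 1) * real (odd_fact m)"
    unfolding card_perfect_matchings[OF assms(1,2)] by (simp add: algebra_simps)
  have "\<delta> * real (card (perfect_matchings S)) = \<delta> * (2 * real m + 1) * real (odd_fact m)"
    unfolding C by simp
  also have "\<dots> \<le> (2 * real m + 1 - real (card B)) * real (odd_fact m)"
    using assms(4) by (intro mult_right_mono) auto
  also have "\<dots> = real (card (perfect_matchings S)) - real (card B * odd_fact m)"
    unfolding C by (simp add: algebra_simps)
  also have "\<dots> \<le> real (card (short_free_matchings S B))"
    using card_short_free_matchings_ge[OF assms(1-3)] by linarith
  finally show ?thesis .
qed

text \<open>Conditioning on an event of probability at least \<open>\<delta>\<close> raises the mean
  of the squared deviation by a factor of at most \<open>1 / \<delta>\<close>. The inequality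
  \<open>AM\<close> passes from squares to absolute values; \<open>t\<close> is left free and
  becomes \<open>sqrt n\<close> later.\<close>

lemma short_free_bridges_deviation:
  assumes S: "finite S" "card S = 2 * Suc (Suc m)" "B \<subseteq> S"
    and \<delta>: "0 < \<delta>" "\<delta> * (2 * real m + 3) \<le> 2 * real m + 3 - real (card B)"
    and t: "0 < t"
  defines "\<mu> \<equiv> real (card B) * real (card (S - B)) / (2 * real m + 3)"
  shows "(\<Sum>M\<in>short_free_matchings S B. \<bar>real (card (bridges M B)) - \<mu>\<bar>) \<le>
    (t + \<mu> / (\<delta> * t)) * real (card (short_free_matchings S B))"
proof -
  let ?A = "short_free_matchings S B"
  let ?D = "\<lambda>M. real (card (bridges M B)) - \<mu>"
  have AM: "\<bar>y\<bar> \<le> t + y\<^sup>2 / t" for y :: real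
  proof -
    have "0 \<le> (\<bar>y\<bar> - t)\<^sup>2 + \<bar>y\<bar> * t" using t by simp
    then have "\<bar>y\<bar> * t \<le> t * t + y\<^sup>2" by (simp add: power2_eq_square algebra_simps)
    then show ?thesis using t by (simp add: field_simps)
  qed
  have "(\<Sum>M\<in>?A. \<bar>?D M\<bar>) \<le> (\<Sum>M\<in>?A. t + (?D M)\<^sup>2 / t)"
    by (intro sum_mono AM)
  also have "\<dots> = t * real (card ?A) + (\<Sum>M\<in>?A. (?D M)\<^sup>2) / t"
    by (simp add: sum.distrib sum_divide_distrib)
  also have "(\<Sum>M\<in>?A. (?D M)\<^sup>2) \<le> (\<Sum>M\<in>perfect_matchings S. (?D M)\<^sup>2)"
    using finite_perfect_matchings[OF S(1)]
    by (intro sum_mono2) (auto simp: short_free_matchings_def)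
  also have "\<dots> \<le> \<mu> * real (card (perfect_matchings S))"
    unfolding \<mu>_def by (rule sum_bridges_deviation_square[OF S])
  also have "\<dots> \<le> \<mu> * (real (card ?A) / \<delta>)"
  proof (rule mult_left_mono)
    show "real (card (perfect_matchings S)) \<le> real (card ?A) / \<delta>"
      using short_free_matchings_large[OF S, of \<delta>] \<delta> by (simp add: field_simps)
  qed (simp add: \<mu>_def)
  finally show ?thesis using t \<delta> by (simp add: field_simps)
qed

section \<open>Diagrams with a prescribed bubble\<close>

text \<open>A short chord through \<open>k - 1\<close> that avoids \<open>k\<close> must be
  \<open>{k - 2, k - 1}\<close>, and similarly on the right. Conversely, a short chord straddling an
  end of the interval would share a vertex with the bounding chord there.\<close>

lemma bubble_iff:
  assumes M: "M \<in> linear_chord_diagrams n" and kl: "1 \<le> k" "k \<le> l" "l \<le> 2 * n"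
  shows "bubble n M {k..l} \<longleftrightarrow>
    (k \<noteq> 1 \<longrightarrow> {k - 2, k - 1} \<in> M) \<and> (l \<noteq> 2 * n \<longrightarrow> {l + 1, l + 2} \<in> M) \<and>
    (\<forall>i. i \<in> {k..l} \<and> Suc i \<in> {k..l} \<longrightarrow> {i, Suc i} \<notin> M)" (is "?L \<longleftrightarrow> ?R1 \<and> ?R2 \<and> ?R3")
proof
  assume ?L
  then obtain k' l' where k': "k' \<le> l'" "{k..l} = {k'..l'}"
    "k' = 1 \<or> (\<exists>c. short_chord M c \<and> k' - 1 \<in> c)"
    "l' = 2*n \<or> (\<exists>c. short_chord M c \<and> l' + 1 \<in> c)"
    and B: "\<And>c. short_chord M c \<Longrightarrow> c \<inter> {k..l} = {}"
    unfolding bubble_def by metis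
  have eq: "k' = k" "l' = l" using k'(1,2) kl(2) by (auto simp: Icc_eq_Icc)
  have ?R1
  proof
    assume "k \<noteq> 1"
    then obtain c i where c: "c \<in> M" "c = {i, Suc i}" "k - 1 \<in> c" "short_chord M c"
      using k'(3) eq by (auto simp: short_chord_def)
    have "i \<noteq> k - 1" using B[OF c(4)] c(2) kl by auto
    then have "Suc i = k - 1" using c by auto
    then have "i = k - 2" by simp
    then show "{k - 2, k - 1} \<in> M" using c \<open>Suc i = k - 1\<close> by simp
  qed
  moreover have ?R2
  proof
    assume "l \<noteq> 2 * n"
    then obtain c i where c: "c \<in> M" "c = {i, Suc i}" "l + 1 \<in> c" "short_chord M c"
      using k'(4) eq by (auto simp: short_chord_def)
    have "i \<noteq> l" using B[OF c(4)] c(2) kl by auto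
    then have "i = l + 1" using c by auto
    then show "{l + 1, l + 2} \<in> M" using c by simp
  qed
  moreover have ?R3
    using B by (fastforce simp: short_chord_def)
  ultimately show "?R1 \<and> ?R2 \<and> ?R3" by blast
next
  assume R: "?R1 \<and> ?R2 \<and> ?R3"
  have M': "M \<in> perfect_matchings {1..2*n}"
    using M by (simp add: linear_chord_diagrams_def perfect_matchings_def)
  then have U: "\<Union>M = {1..2*n}" by (simp add: perfect_matchings_def partition_on_def)
  have "k = 1 \<or> (\<exists>c. short_chord M c \<and> k - 1 \<in> c)"
  proof (cases "k = 1")
    case False
    then have "Suc (k - 2) = k - 1" using kl by simp
    then show ?thesis using False R
      by (intro disjI2 exI[of _ "{k - 2, k - 1}"]) (auto simp: short_chord_def intro!: exI[of _ "k - 2"])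
  qed simp
  moreover have "l = 2*n \<or> (\<exists>c. short_chord M c \<and> l + 1 \<in> c)"
    using R by (auto simp: short_chord_def intro!: exI[of _ "{l + 1, l + 2}"])
  moreover have "c \<inter> {k..l} = {}" if sc: "short_chord M c" for c
  proof -
    obtain i where c: "c \<in> M" "c = {i, Suc i}" using sc by (auto simp: short_chord_def)
    \<comment> \<open>These bounds exclude straddling at an end of the diagram, where there is no
      bounding chord to collide with.\<close>
    then have i: "1 \<le> i" "Suc i \<le> 2 * n" using U by (metis Union_iff atLeastAtMost_iff insert_iff)+
    have "\<not> (i \<in> {k..l} \<and> Suc i \<in> {k..l})" using R c by blast
    moreover have "Suc i \<noteq> k"
    proof
      assume *: "Suc i = k"
      then have "k \<noteq> 1" using i by simp
      then have "{k - 2, k - 1} = {i, Suc i}"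
        using R c * by (intro perfect_matchings_unique[OF M', of _ _ i]) auto
      then show False using * i by (auto simp: doubleton_eq_iff)
    qed
    moreover have "i \<noteq> l"
    proof
      assume *: "i = l"
      then have "l \<noteq> 2 * n" using i by simp
      then have "{l + 1, l + 2} = {i, Suc i}"
        using R c * by (intro perfect_matchings_unique[OF M', of _ _ "Suc i"]) auto
      then show False using * by (auto simp: doubleton_eq_iff)
    qed
    ultimately show ?thesis using c by auto
  qed
  ultimately show ?L
    unfolding bubble_def using kl by blast
qed

lemma perfect_matchings_subfamily:
  assumes "M \<in> perfect_matchings S" "T \<subseteq> M"
  shows "T \<in> perfect_matchings (\<Union>T)"
  using assms unfolding perfect_matchings_def partition_on_def disjoint_def by blast

lemma card_Union_perfect_matching:
  assumes "T \<in> perfect_matchings U"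
  shows "card U = 2 * card T"
proof -
  have T: "\<Union>T = U" "disjoint T" "\<forall>c\<in>T. card c = 2"
    using assms by (auto simp: perfect_matchings_def partition_on_def)
  then have "card (\<Union>T) = (\<Sum>c\<in>T. card c)"
    by (intro card_Union_disjoint) (auto simp: disjoint_def pairwise_def disjnt_def intro: card_ge_0_finite)
  then show ?thesis using T by simp
qed

text \<open>For \<open>k = 2\<close> or \<open>l = 2 * n - 1\<close> a chord leaves
  \<open>{1..2*n}\<close>, in accordance with the fact that no bubble begins or ends there. Hence it
  has to be assumed or derived below that these chords lie in the diagram.\<close>

definition bounding_chords :: "nat \<Rightarrow> nat \<Rightarrow> nat \<Rightarrow> nat set set" where
  "bounding_chords n k l = (if k = 1 then {} else {{k - 2, k - 1}}) \<union>
     (if l = 2 * n then {} else {{l + 1, l + 2}})"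

definition diagrams_with_bubble :: "nat \<Rightarrow> nat set \<Rightarrow> nat set set set" where
  "diagrams_with_bubble n B = {M \<in> linear_chord_diagrams n. bubble n M B}"

lemma bounding_chords_disjnt: "1 \<le> k \<Longrightarrow> \<Union>(bounding_chords n k l) \<inter> {k..l} = {}"
  by (auto simp: bounding_chords_def split: if_splits)

lemma card_bounding_chords_le: "card (bounding_chords n k l) \<le> 2"
  by (auto simp: bounding_chords_def card_insert_if)

lemma linear_chord_diagrams_eq: "linear_chord_diagrams n = perfect_matchings {1..2*n}"
  by (simp add: linear_chord_diagrams_def perfect_matchings_def)

text \<open>The end conditions of \<open>bubble_iff\<close> say that the diagram contains
  \<open>T\<close>, and the remaining condition is insensitive to \<open>T\<close>, whose chords
  avoid \<open>{k..l}\<close>. The extension bijection therefore restricts.\<close>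

lemma bij_betw_diagrams_with_bubble:
  assumes kl: "1 \<le> k" "k \<le> l" "l \<le> 2 * n"
  defines "T \<equiv> bounding_chords n k l"
  assumes T: "T \<in> perfect_matchings (\<Union>T)" "\<Union>T \<subseteq> {1..2*n}"
  shows "bij_betw (\<lambda>M. M \<union> T) (short_free_matchings ({1..2*n} - \<Union>T) {k..l})
    (diagrams_with_bubble n {k..l})"
proof -
  let ?Q = "\<lambda>M. \<forall>i. i \<in> {k..l} \<and> Suc i \<in> {k..l} \<longrightarrow> {i, Suc i} \<notin> M"
  have "diagrams_with_bubble n {k..l} = {M \<in> {M \<in> perfect_matchings {1..2*n}. T \<subseteq> M}. ?Q M}"
    using bubble_iff[OF _ kl]
    by (auto simp: diagrams_with_bubble_def linear_chord_diagrams_eq T_def bounding_chords_def)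
  moreover have "?Q (M \<union> T) \<longleftrightarrow> ?Q M" for M
  proof -
    have "{i, Suc i} \<notin> T" if "i \<in> {k..l}" for i
      using bounding_chords_disjnt[OF kl(1), of n l] that unfolding T_def by blast
    then show ?thesis by blast
  qed
  ultimately show ?thesis
    unfolding short_free_matchings_def
    using bij_betw_Collect[OF bij_betw_perfect_matchings_extend[OF T], of ?Q ?Q] by simp
qed

text \<open>Removing the at most two bounding chords changes the mean number of bridges by at most 5.\<close>
lemma mean_shift:
  fixes N Q s :: real
  assumes "0 \<le> s" "s \<le> 2" "1 \<le> Q" "Q \<le> 2 * N - 5"
  shows "\<bar>Q * (2 * N - 2 * s - Q) / (2 * N - 2 * s - 1) - Q * (2 * N - Q) / (2 * N)\<bar> \<le> 5"
proof -
  define D where "D = 2 * N - 2 * s - 1"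
  have D: "D > 0" "Q \<le> D" "N > 0" using assms by (simp_all add: D_def)
  \<comment> \<open>The first factor is at most 1, and the second at most
    \<open>10 * N / (2 * N)\<close> in absolute value, whence the 5.\<close>
  have eq: "Q * (2 * N - 2 * s - Q) / D - Q * (2 * N - Q) / (2 * N) =
    (Q / D) * (((2 * N - Q) * (2 * s + 1) - 4 * s * N) / (2 * N))"
    using D by (simp add: field_simps) (simp add: D_def algebra_simps)
  have "(2 * N - Q) * (2 * s + 1) \<le> (2 * N) * 5" "0 \<le> (2 * N - Q) * (2 * s + 1)"
    using assms by (intro mult_mono mult_nonneg_nonneg; simp)+
  moreover have "4 * s * N \<le> 8 * N" "0 \<le> 4 * s * N"
    using assms D by (auto intro!: mult_right_mono)
  ultimately have "\<bar>(2 * N - Q) * (2 * s + 1) - 4 * s * N\<bar> \<le> 10 * N"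
    using D by linarith
  then have "\<bar>((2 * N - Q) * (2 * s + 1) - 4 * s * N) / (2 * N)\<bar> \<le> 5"
    using D by (simp add: abs_divide field_simps)
  moreover have "\<bar>Q / D\<bar> \<le> 1" using D assms by (simp add: abs_divide)
  ultimately have "\<bar>Q / D\<bar> * \<bar>((2 * N - Q) * (2 * s + 1) - 4 * s * N) / (2 * N)\<bar> \<le> 1 * 5"
    by (intro mult_mono) auto
  then show ?thesis unfolding D_def[symmetric] eq abs_mult by simp
qed

section \<open>Deviation for one bubble, then for the average over all bubbles\<close>

text \<open>The conditional bound is used with \<open>t = sqrt n\<close>, and replacing
  \<open>\<mu>\<close> by \<open>a\<close> costs 5. The 5 in the hypothesis on
  \<open>\<delta>\<close> covers the loss of \<open>2 * s + 1\<close> when \<open>s \<le> 2\<close>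
  bounding chords are removed.\<close>

lemma diagrams_with_bubble_deviation:
  assumes kl: "1 \<le> k" "k \<le> l" "l \<le> 2 * n"
    and \<delta>: "0 < \<delta>" "2 * real n * \<delta> \<le> 2 * real n - 5 - real q"
    and q: "q = card {k..l}"
  defines "a \<equiv> real q * (2 * real n - real q) / (2 * real n)"
  shows "(\<Sum>M\<in>diagrams_with_bubble n {k..l}. \<bar>real (card (bridges M {k..l})) - a\<bar>) \<le>
    (5 + sqrt n + 2 * sqrt n / \<delta>) * real (card (diagrams_with_bubble n {k..l}))"
proof (cases "diagrams_with_bubble n {k..l} = {}")
  case False
  let ?B = "{k..l}" and ?X = "\<lambda>M. real (card (bridges M {k..l}))"
  define T S where "T = bounding_chords n k l" and "S = {1..2*n} - \<Union>T"
  define s where "s = card T"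
  \<comment> \<open>A diagram with this bubble certifies that the bounding chords are disjoint and
    lie in \<open>{1..2*n}\<close>.\<close>
  obtain M0 where M0: "M0 \<in> perfect_matchings {1..2*n}" "bubble n M0 ?B"
    using False by (auto simp: diagrams_with_bubble_def linear_chord_diagrams_eq)
  have TM0: "T \<subseteq> M0"
    using bubble_iff[OF _ kl, of M0] M0
    by (auto simp: T_def bounding_chords_def linear_chord_diagrams_eq)
  have T: "T \<in> perfect_matchings (\<Union>T)"
    by (rule perfect_matchings_subfamily[OF M0(1) TM0])
  have U: "\<Union>T \<subseteq> {1..2*n}"
    using TM0 M0(1) unfolding perfect_matchings_def partition_on_def by blast
  have disj: "\<Union>T \<inter> ?B = {}" unfolding T_def by (rule bounding_chords_disjnt[OF kl(1)])
  have bij: "bij_betw (\<lambda>M. M \<union> T) (short_free_matchings S ?B) (diagrams_with_bubble n ?B)"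
    unfolding S_def T_def by (rule bij_betw_diagrams_with_bubble[OF kl]) (use T U T_def in simp_all)
  have br: "bridges (M \<union> T) ?B = bridges M ?B" for M
    using disj unfolding bridges_def by blast
  have q1: "1 \<le> q" using q kl by simp
  have "2 * real n * \<delta> > 0" using kl \<delta> by simp
  then have n: "5 + q < 2 * n" using \<delta> by linarith
  have s2: "s \<le> 2" unfolding s_def T_def by (rule card_bounding_chords_le)
  define m where "m = n - s - 2"
  have m: "n = m + s + 2" unfolding m_def using s2 n q1 by simp
  have "card S = 2 * n - 2 * s"
    unfolding S_def s_def using U card_Union_perfect_matching[OF T]
    by (simp add: card_Diff_subset finite_subset)
  then have cS: "card S = 2 * Suc (Suc m)" using m by simp
  have BS: "?B \<subseteq> S" using disj kl by (auto simp: S_def)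
  have fS: "finite S" by (simp add: S_def)
  have cR: "card (S - ?B) = 2 * m + 4 - q"
    using BS cS q by (simp add: card_Diff_subset)
  have qS: "q \<le> 2 * m + 4" using card_mono[OF fS BS] cS q by simp
  have rR: "real (card (S - ?B)) = 2 * real n - 2 * real s - real q"
    using m qS by (simp add: cR of_nat_diff)
  have K: "2 * real m + 3 = 2 * real n - 2 * real s - 1" using m by simp
  define \<mu> where "\<mu> = real q * real (card (S - ?B)) / (2 * real m + 3)"
  have \<mu>a: "\<bar>\<mu> - a\<bar> \<le> 5"
    unfolding \<mu>_def a_def rR K using s2 n q1 by (intro mean_shift) auto
  \<comment> \<open>As \<open>a \<le> q\<close>, the shift by 5 still leaves
    \<open>\<mu> \<le> 2 * n\<close>, which makes \<open>\<mu> / (\<delta> * sqrt n)\<close> of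
    order \<open>sqrt n\<close>.\<close>
  have a: "a \<le> 2 * real n - 5"
  proof -
    have "a = real q * ((2 * real n - real q) / (2 * real n))" by (simp add: a_def)
    also have "\<dots> \<le> real q * 1" using n by (intro mult_left_mono) auto
    finally show ?thesis using n by linarith
  qed
  have "\<mu> \<le> 2 * real n" using \<mu>a a by linarith
  have sn: "sqrt n > 0" using n by simp
  have "\<delta> * (2 * real m + 3) \<le> \<delta> * (2 * real n)"
    unfolding K using \<delta> by (intro mult_left_mono) auto
  also have "\<dots> \<le> 2 * real m + 3 - real (card ?B)"
    unfolding K q[symmetric] using \<delta> s2 by (simp add: mult_ac)
  finally have dev: "(\<Sum>M\<in>short_free_matchings S ?B. \<bar>?X M - \<mu>\<bar>) \<le>
    (sqrt n + \<mu> / (\<delta> * sqrt n)) * real (card (short_free_matchings S ?B))"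
    unfolding \<mu>_def q using short_free_bridges_deviation[OF fS cS BS \<delta>(1) _ sn] by simp
  have "(\<Sum>M\<in>diagrams_with_bubble n ?B. \<bar>?X M - a\<bar>) = (\<Sum>M\<in>short_free_matchings S ?B. \<bar>?X M - a\<bar>)"
    using sum.reindex_bij_betw[OF bij, of "\<lambda>M. \<bar>?X M - a\<bar>"] by (simp add: br)
  also have "\<dots> \<le> (\<Sum>M\<in>short_free_matchings S ?B. \<bar>?X M - \<mu>\<bar> + 5)"
    using \<mu>a by (intro sum_mono) linarith
  also have "\<dots> \<le> (5 + sqrt n + \<mu> / (\<delta> * sqrt n)) * real (card (short_free_matchings S ?B))"
    using dev by (simp add: sum.distrib algebra_simps)
  also have "\<dots> \<le> (5 + sqrt n + 2 * sqrt n / \<delta>) * real (card (short_free_matchings S ?B))"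
  proof (intro mult_right_mono add_left_mono)
    have "\<mu> / (\<delta> * sqrt n) \<le> 2 * real n / (\<delta> * sqrt n)"
      using \<open>\<mu> \<le> 2 * real n\<close> \<delta>(1) by (intro divide_right_mono) auto
    also have "\<dots> = 2 * sqrt n / \<delta>"
      using sn \<delta>(1) by (simp add: field_simps)
    finally show "\<mu> / (\<delta> * sqrt n) \<le> 2 * sqrt n / \<delta>" .
  qed simp
  also have "card (short_free_matchings S ?B) = card (diagrams_with_bubble n ?B)"
    by (rule bij_betw_same_card[OF bij])
  finally show ?thesis .
qed simp

text \<open>This keeps \<open>mean_bridges\<close> from taking its default value 0. An initial
  bubble needs only one bounding chord, and the union bound leaves at least one matching of the
  rest.\<close>

lemma diagrams_with_initial_bubble_nonempty:
  assumes "1 \<le> q" "q + 5 \<le> 2 * n"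
  shows "diagrams_with_bubble n {1..q} \<noteq> {}"
proof -
  define T where "T = bounding_chords n 1 q"
  have T: "T = {{q + 1, q + 2}}" using assms by (simp add: T_def bounding_chords_def)
  have Tm: "T \<in> perfect_matchings (\<Union>T)" unfolding T using perfect_matchings_singleton[of "q + 1" "q + 2"] by simp
  have U: "\<Union>T \<subseteq> {1..2*n}" using assms by (simp add: T)
  define S where "S = {1..2*n} - \<Union>T"
  define m where "m = n - 2"
  have cS: "card S = 2 * Suc m"
    using U assms card_Union_perfect_matching[OF Tm] unfolding S_def m_def
    by (simp add: card_Diff_subset finite_subset T)
  have S: "finite S" "{1..q} \<subseteq> S" using assms by (auto simp: S_def T)
  have "real q < 2 * real m + 1" using assms by (simp add: m_def of_nat_diff)
  \<comment> \<open>This is the largest value that \<open>short_free_matchings_large\<close>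
    admits.\<close>
  define \<delta> where "\<delta> = (2 * real m + 1 - real q) / (2 * real m + 1)"
  have "0 < \<delta> * real (card (perfect_matchings S))"
    using \<open>real q < 2 * real m + 1\<close> odd_fact_pos[of "Suc m"] card_perfect_matchings[OF S(1) cS]
    by (simp add: \<delta>_def del: odd_fact.simps)
  also have "\<dots> \<le> real (card (short_free_matchings S {1..q}))"
    by (rule short_free_matchings_large[OF S(1) cS S(2)]) (simp add: \<delta>_def)
  also have "card (short_free_matchings S {1..q}) = card (diagrams_with_bubble n {1..q})"
    unfolding S_def T_def using assms Tm U T_def
    by (intro bij_betw_same_card[OF bij_betw_diagrams_with_bubble]) auto
  finally show ?thesis by auto
qed

text \<open>Grouping pairs by their number of bridges recovers the defining sums. The bubble is put
  first so that the sums split bubble by bubble.\<close>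

lemma mean_bridges_eq:
  defines "\<B> \<equiv> \<lambda>n q. SIGMA B:{B \<in> Pow {1..2*n}. card B = q}. diagrams_with_bubble n B"
  shows "mean_bridges n q =
    (\<Sum>(B, M)\<in>\<B> n q. real (card (bridges M B))) / real (card (\<B> n q))"
proof -
  let ?b = "\<lambda>(B, M). card (bridges M B)"
  have fin: "finite (\<B> n q)"
    by (auto simp: \<B>_def diagrams_with_bubble_def linear_chord_diagrams_eq finite_perfect_matchings)
  \<comment> \<open>The cutoff at \<open>n\<close> in the definition of the mean loses
    nothing.\<close>
  have sub: "?b ` \<B> n q \<subseteq> {..n}"
    by (auto simp: \<B>_def diagrams_with_bubble_def card_bridges_le)
  have num: "num_bubbles n q b = card {x \<in> \<B> n q. ?b x = b}" for b
  proof -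
    have "bij_betw prod.swap {x \<in> \<B> n q. ?b x = b} (bubbles_with_bridges n q b)"
      by (rule bij_betw_byWitness[where f' = prod.swap])
         (auto simp: \<B>_def bubbles_with_bridges_def diagrams_with_bubble_def bubble_def)
    then show ?thesis unfolding num_bubbles_def by (rule bij_betw_same_card[symmetric])
  qed
  have "(\<Sum>b\<le>n. real b * real (num_bubbles n q b)) =
      (\<Sum>b\<le>n. \<Sum>x\<in>{x \<in> \<B> n q. ?b x = b}. real (?b x))"
    unfolding num by (intro sum.cong) auto
  also have "\<dots> = (\<Sum>x\<in>\<B> n q. real (?b x))"
    by (rule sum.group[OF fin _ sub]) simp
  finally have 1: "(\<Sum>b\<le>n. real b * real (num_bubbles n q b)) = (\<Sum>x\<in>\<B> n q. real (?b x))" .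
  have "(\<Sum>b\<le>n. real (num_bubbles n q b)) = (\<Sum>b\<le>n. \<Sum>x\<in>{x \<in> \<B> n q. ?b x = b}. 1)"
    unfolding num by simp
  also have "\<dots> = (\<Sum>x\<in>\<B> n q. 1)"
    by (rule sum.group[OF fin _ sub]) simp
  finally show ?thesis
    unfolding mean_bridges_def 1 by (simp add: case_prod_unfold)
qed

text \<open>The bound for one bubble does not depend on its position, so it survives
  averaging.\<close>

lemma mean_bridges_deviation:
  assumes \<delta>: "0 < \<delta>" "2 * real n * \<delta> \<le> 2 * real n - 5 - real q" and q: "1 \<le> q"
  shows "\<bar>mean_bridges n q - real q * (2 * real n - real q) / (2 * real n)\<bar> \<le>
    5 + sqrt n + 2 * sqrt n / \<delta>"
proof -
  define a K where "a = real q * (2 * real n - real q) / (2 * real n)"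
    and "K = 5 + sqrt n + 2 * sqrt n / \<delta>"
  define I where "I = {B \<in> Pow {1..2*n}. card B = q}"
  define \<B> where "\<B> = (SIGMA B:I. diagrams_with_bubble n B)"
  have fI: "finite I" by (simp add: I_def)
  have fD: "finite (diagrams_with_bubble n B)" for B
    by (simp add: diagrams_with_bubble_def linear_chord_diagrams_eq finite_perfect_matchings)
  have f: "finite \<B>" by (simp add: \<B>_def fI fD)
  have "2 * real n * \<delta> \<ge> 0" using \<delta> by simp
  then have qn: "q + 5 \<le> 2 * n" using \<delta> by linarith
  have "{1..q} \<in> I" using qn by (auto simp: I_def)
  then have "\<B> \<noteq> {}"
    using diagrams_with_initial_bubble_nonempty[OF q qn] by (auto simp: \<B>_def)
  then have pos: "real (card \<B>) > 0" using f by (simp add: card_gt_0_iff)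
  have dev: "(\<Sum>M\<in>diagrams_with_bubble n B. \<bar>real (card (bridges M B)) - a\<bar>) \<le>
      K * real (card (diagrams_with_bubble n B))" if B: "B \<in> I" for B
  \<comment> \<open>A set that is a bubble of no diagram contributes nothing; any other is an
    interval.\<close>
  proof (cases "diagrams_with_bubble n B = {}")
    case False
    then obtain k l where kl: "1 \<le> k" "k \<le> l" "l \<le> 2 * n" "B = {k..l}"
      unfolding diagrams_with_bubble_def bubble_def by blast
    moreover have "q = card {k..l}" using B kl(4) by (simp add: I_def)
    ultimately show ?thesis
      unfolding a_def K_def using diagrams_with_bubble_deviation[OF kl(1-3) \<delta>] by blast
  qed simp
  have "mean_bridges n q - a = (\<Sum>(B, M)\<in>\<B>. real (card (bridges M B)) - a) / real (card \<B>)"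
    unfolding mean_bridges_eq I_def[symmetric] \<B>_def[symmetric]
    using pos by (simp add: case_prod_unfold sum_subtractf field_simps)
  also have "\<bar>\<dots>\<bar> \<le> (\<Sum>(B, M)\<in>\<B>. \<bar>real (card (bridges M B)) - a\<bar>) / real (card \<B>)"
    using sum_abs[of "\<lambda>(B, M). real (card (bridges M B)) - a" \<B>] pos
    by (simp add: abs_divide case_prod_unfold divide_right_mono)
  also have "(\<Sum>(B, M)\<in>\<B>. \<bar>real (card (bridges M B)) - a\<bar>) =
      (\<Sum>B\<in>I. \<Sum>M\<in>diagrams_with_bubble n B. \<bar>real (card (bridges M B)) - a\<bar>)"
    unfolding \<B>_def using fI fD by (intro sum.Sigma[symmetric]) auto
  also have "\<dots> \<le> (\<Sum>B\<in>I. K * real (card (diagrams_with_bubble n B)))"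
    by (intro sum_mono dev)
  also have "\<dots> = K * real (card \<B>)"
    unfolding \<B>_def using fI fD by (simp add: sum_distrib_left)
  finally show ?thesis using pos by (simp add: a_def K_def divide_right_mono)
qed

theorem theorem1:
  fixes q :: "nat \<Rightarrow> nat" and c :: real
  assumes "0 < c" and "c < 2"
    and "(\<lambda>n. real (q n) / real n) \<longlonglongrightarrow> c"
  shows "(\<lambda>n. mean_bridges n (q n)) \<sim>[sequentially]
           (\<lambda>n. real (q n) * (2 * real n - real (q n)) / (2 * real n))"
proof (rule asymp_equivI')
  let ?a = "\<lambda>n. real (q n) * (2 * real n - real (q n)) / (2 * real n)"
  \<comment> \<open>The limits below are \<open>4 * \<delta>\<close> and
    \<open>2 * \<kappa>\<close>, so \<open>2 * \<delta>\<close> and \<open>\<kappa>\<close> are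
    eventually exceeded. The former, multiplied by \<open>n\<close>, is the term in the hypothesis
    of \<open>mean_bridges_deviation\<close>.\<close>
  define \<delta> \<kappa> where "\<delta> = (2 - c) / 4" and "\<kappa> = c * (2 - c) / 4"
  have \<delta>: "\<delta> > 0" and \<kappa>: "\<kappa> > 0" using assms(1,2) by (simp_all add: \<delta>_def \<kappa>_def)
  have lim: "(\<lambda>n. real (q n) / real n) \<longlonglongrightarrow> c" by (rule assms(3))
  have ev1: "\<forall>\<^sub>F n in sequentially. real (q n) / real n > 0"
    by (rule order_tendstoD(1)[OF lim assms(1)])
  have "(\<lambda>n. 2 - real (q n) / real n - 5 / real n) \<longlonglongrightarrow> 2 - c - 0"
    by (intro tendsto_diff lim tendsto_const) real_asymp
  then have ev2: "\<forall>\<^sub>F n in sequentially. 2 - real (q n) / real n - 5 / real n > 2 * \<delta>"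
    by (rule order_tendstoD(1)) (use assms(2) in \<open>simp add: \<delta>_def\<close>)
  have "(\<lambda>n. (real (q n) / real n) * (2 - real (q n) / real n) / 2) \<longlonglongrightarrow> c * (2 - c) / 2"
    by (intro tendsto_intros lim) simp
  then have ev3: "\<forall>\<^sub>F n in sequentially. (real (q n) / real n) * (2 - real (q n) / real n) / 2 > \<kappa>"
    by (rule order_tendstoD(1)) (use \<kappa> in \<open>simp add: \<kappa>_def\<close>)
  have bound: "\<forall>\<^sub>F n in sequentially. norm (mean_bridges n (q n) / ?a n - 1) \<le>
      (5 + sqrt n + 2 * sqrt n / \<delta>) / (\<kappa> * real n)"
    using ev1 ev2 ev3 eventually_gt_at_top[of 0]
  proof eventually_elim
    case (elim n)
    have n: "real n > 0" using elim(4) by simp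
    have "real (q n) > 0" using elim(1) n by (simp add: zero_less_divide_iff)
    then have q1: "1 \<le> q n" by simp
    have "2 * real n * \<delta> \<le> 2 * real n - 5 - real (q n)"
      using mult_strict_right_mono[OF elim(2) n] n by (simp add: algebra_simps)
    then have dev: "\<bar>mean_bridges n (q n) - ?a n\<bar> \<le> 5 + sqrt n + 2 * sqrt n / \<delta>"
      by (rule mean_bridges_deviation[OF \<delta> _ q1])
    have "?a n = real n * ((real (q n) / real n) * (2 - real (q n) / real n) / 2)"
      using n by (simp add: field_simps)
    also have "\<dots> \<ge> real n * \<kappa>"
      using elim(3) n by (intro mult_left_mono) auto
    finally have a: "?a n \<ge> \<kappa> * real n" by (simp add: mult.commute)
    have pos: "\<kappa> * real n > 0" using \<kappa> n by simp
    then have apos: "?a n > 0" using a by linarith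
    have "norm (mean_bridges n (q n) / ?a n - 1) = \<bar>(mean_bridges n (q n) - ?a n) / ?a n\<bar>"
      using apos by (simp only: real_norm_def diff_divide_distrib divide_self)
    also have "\<dots> = \<bar>mean_bridges n (q n) - ?a n\<bar> / ?a n"
      unfolding abs_divide[of _ "?a n"] abs_of_pos[OF apos] ..
    also have "\<dots> \<le> (5 + sqrt n + 2 * sqrt n / \<delta>) / (\<kappa> * real n)"
      by (rule frac_le[OF _ dev pos a]) (use \<delta> in simp)
    finally show ?case .
  qed
  \<comment> \<open>A deviation of order \<open>sqrt n\<close> against a main term of at least
    \<open>\<kappa> * n\<close> makes the relative error of order \<open>1 / sqrt n\<close>.\<close>
  have "(\<lambda>n. (5 + sqrt n + 2 * sqrt n / \<delta>) / (\<kappa> * real n)) \<longlonglongrightarrow> 0"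
    using \<delta> \<kappa> by real_asymp
  then have "(\<lambda>n. mean_bridges n (q n) / ?a n - 1) \<longlonglongrightarrow> 0"
  proof (rule tendsto_0_le[where K = 1])
    show "\<forall>\<^sub>F n in sequentially. norm (mean_bridges n (q n) / ?a n - 1) \<le>
        norm ((5 + sqrt n + 2 * sqrt n / \<delta>) / (\<kappa> * real n)) * 1"
      using bound
    proof eventually_elim
      case (elim n)
      also have "y \<le> norm y * 1" for y :: real by simp
      finally show ?case .
    qed
  qed
  then show "(\<lambda>n. mean_bridges n (q n) / ?a n) \<longlonglongrightarrow> 1"
    by (simp add: LIM_zero_iff)
qed

end
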